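(* Let $N\in\{2,3\}$. There are no eigenvalues of the pencil $\mathcal L$ of finite geometric multiplicity; that is, for every $\omega\in D(\varepsilon)$ the space $\ker L(\omega)$ is either $\{0\}$ or infinite-dimensional.
   Context: Setting. Let $N\in\{2,3\}$, $\mathbb R_+=(0,\infty)$, $\mathbb R_-=(-\infty,0)$. The permittivity is $\varepsilon(x_1,\omega)=\varepsilon_\pm(x_1,\omega)$ for $\pm x_1>0$, where $\varepsilon_\pm(\cdot,\omega)$ are complex-valued functions on $\mathbb R_\pm$ depending in an arbitrary way on a complex parameter $\omega$. $D(\varepsilon):=\{\omega\in\mathbb C:\varepsilon_+(\cdot,\omega)\in W^{3,\infty}(\mathbb R_+),\ \varepsilon_-(\cdot,\omega)\in W^{3,\infty}(\mathbb R_-)\}$ is assumed non-empty. Pencil. $\nabla=(\partial_{x_1},\partial_{x_2},\partial_{x_3})^\top$ if $N=3$, $\nabla=(\partial_{x_1},\partial_{x_2},0)^\top$ if $N=2$. For $\omega\in D(\varepsilon)$, $\mathcal D_\omega:=\{E\in L^2(\mathbb R^N)^3:\nabla\times E,\ \nabla\times\nabla\times E\in L^2(\mathbb R^N)^3,\ \nabla\cdot(\varepsilon(\cdot,\omega)E)=0\}$ (distributionally; $\varepsilon(\cdot,\omega)$ acts as a function of $x_1$ only; functions are $\mathbb C^3$-valued), $\mathcal R:=\{f\in L^2(\mathbb R^N)^3:\nabla\cdot f=0\}$, $L(\omega):\mathcal D_\omega\to\mathcal R$, $L(\omega)E:=\nabla\times\nabla\times E-\omega^2\varepsilon(x_1,\omega)E$,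 $\mathcal L:=(L(\omega))_{\omega\in D(\varepsilon)}$. An eigenvalue of $\mathcal L$ is an $\omega\in D(\varepsilon)$ with $\ker L(\omega)\ne\{0\}$; its geometric multiplicity is $\dim\ker L(\omega)$. *)

theory Defs
  imports "HOL-Analysis.Analysis"
begin

section \<open>Test functions\<close>

definition dir_deriv :: "'a::euclidean_space \<Rightarrow> ('a \<Rightarrow> complex) \<Rightarrow> 'a \<Rightarrow> complex" where
  "dir_deriv v \<phi> x = frechet_derivative \<phi> (at x) v"

primrec Ck :: "nat \<Rightarrow> ('a::euclidean_space \<Rightarrow> complex) \<Rightarrow> bool" where
  "Ck 0 \<phi> \<longleftrightarrow> continuous_on UNIV \<phi>"
| "Ck (Suc k) \<phi> \<longleftrightarrow> \<phi> differentiable_on UNIV \<and> (\<forall>b\<in>Basis. Ck k (dir_deriv b \<phi>))"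

text \<open>The space \<open>C\<^sub>c\<^sup>\<infinity>(U)\<close> for open \<open>U\<close>, its elements being extended by zero to the whole space.\<close>

definition test_functions :: "'a::euclidean_space set \<Rightarrow> ('a \<Rightarrow> complex) set" where
  "test_functions U =
     {\<phi>. (\<forall>k. Ck k \<phi>) \<and> compact (closure {x. \<phi> x \<noteq> 0}) \<and> closure {x. \<phi> x \<noteq> 0} \<subseteq> U}"

section \<open>The function spaces\<close>

text \<open>Elements of Lebesgue and Sobolev spaces are represented by functions; equality in these spaces
  is equality almost everywhere. For functions on an open subset \<open>I\<close> of the real line, the values
  outside \<open>I\<close> play no role.\<close>

definition Linfty :: "real set \<Rightarrow> (real \<Rightarrow> complex) set" where
  "Linfty I = {f \<in> borel_measurable (lebesgue_on I). \<exists>M. AE t in lebesgue_on I. norm (f t) \<le> M}"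

definition Sobolev_infty :: "nat \<Rightarrow> real set \<Rightarrow> (real \<Rightarrow> complex) set" where
  "Sobolev_infty m I =
     {f \<in> Linfty I. \<forall>k\<in>{1..m}. \<exists>g \<in> Linfty I. \<forall>\<phi> \<in> test_functions I.
        (LINT t|lebesgue_on I. f t * (dir_deriv 1 ^^ k) \<phi> t)
          = (-1) ^ k * (LINT t|lebesgue_on I. g t * \<phi> t)}"

definition L2 :: "(real^'n \<Rightarrow> complex^3) set" where
  "L2 = {E \<in> borel_measurable lebesgue. integrable lebesgue (\<lambda>x. (norm (E x))\<^sup>2)}"

section \<open>Distributional curl and divergence\<close>

text \<open>The three-component gradient on \<open>\<real>\<^sup>N\<close>, \<open>N \<in> {2,3}\<close>. Only the index types \<open>2\<close> and \<open>3\<close> are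
  intended; in the index type \<open>2\<close> the numerals \<open>1\<close> and \<open>2\<close> denote the two distinct indices.\<close>

definition nabla :: "(real^'n::{finite,numeral} \<Rightarrow> complex) \<Rightarrow> real^'n::{finite,numeral} \<Rightarrow> complex^3" where
  "nabla \<phi> x = vector [dir_deriv (axis 1 1) \<phi> x, dir_deriv (axis 2 1) \<phi> x,
                        if CARD('n::{finite,numeral}) = 3 then dir_deriv (axis 3 1) \<phi> x else 0]"

definition ccross :: "complex^3 \<Rightarrow> complex^3 \<Rightarrow> complex^3" where
  "ccross a b = vector [a$2 * b$3 - a$3 * b$2, a$3 * b$1 - a$1 * b$3, a$1 * b$2 - a$2 * b$1]"

text \<open>\<open>\<nabla> \<times> E = F\<close> in the sense of distributions, with \<open>E\<close> and \<open>F\<close> in \<open>L\<^sup>2\<close>: each component of the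
  distribution \<open>\<nabla> \<times> E\<close> is tested with the scalar function \<open>\<phi>\<close>, the derivatives being moved to \<open>\<phi>\<close>.\<close>

definition has_curl :: "(real^'n::{finite,numeral} \<Rightarrow> complex^3) \<Rightarrow> (real^'n::{finite,numeral} \<Rightarrow> complex^3) \<Rightarrow> bool"
    (infix "has'_curl" 50) where
  "E has_curl F \<longleftrightarrow> E \<in> L2 \<and> F \<in> L2 \<and>
     (\<forall>\<phi> \<in> test_functions UNIV.
        (LINT x|lebesgue. \<phi> x *s F x) = - (LINT x|lebesgue. ccross (nabla \<phi> x) (E x)))"

text \<open>Used only for fields whose product with test functions is integrable.\<close>

definition div_free :: "(real^'n::{finite,numeral} \<Rightarrow> complex^3) \<Rightarrow> bool" where
  "div_free G \<longleftrightarrow>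
     (\<forall>\<phi> \<in> test_functions UNIV. (LINT x|lebesgue. (\<Sum>j\<in>UNIV. nabla \<phi> x $ j * G x $ j)) = 0)"

section \<open>The pencil\<close>

definition permittivity ::
    "(real \<Rightarrow> complex \<Rightarrow> complex) \<Rightarrow> (real \<Rightarrow> complex \<Rightarrow> complex) \<Rightarrow> real \<Rightarrow> complex \<Rightarrow> complex" where
  "permittivity eps\<^sub>p eps\<^sub>m t \<omega> = (if t > 0 then eps\<^sub>p t \<omega> else if t < 0 then eps\<^sub>m t \<omega> else 0)"

definition param_domain ::
    "(real \<Rightarrow> complex \<Rightarrow> complex) \<Rightarrow> (real \<Rightarrow> complex \<Rightarrow> complex) \<Rightarrow> complex set" where
  "param_domain eps\<^sub>p eps\<^sub>m =
     {\<omega>. (\<lambda>t. eps\<^sub>p t \<omega>) \<in> Sobolev_infty 3 {0<..} \<and> (\<lambda>t. eps\<^sub>m t \<omega>) \<in> Sobolev_infty 3 {..<0}}"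

definition pencil_domain ::
    "(real \<Rightarrow> complex \<Rightarrow> complex) \<Rightarrow> (real \<Rightarrow> complex \<Rightarrow> complex) \<Rightarrow> complex
       \<Rightarrow> (real^'n::{finite,numeral} \<Rightarrow> complex^3) set" where
  "pencil_domain eps\<^sub>p eps\<^sub>m \<omega> =
     {E \<in> L2. (\<exists>F G. E has_curl F \<and> F has_curl G) \<and>
              div_free (\<lambda>x. permittivity eps\<^sub>p eps\<^sub>m (x$1) \<omega> *s E x)}"

text \<open>The graph of \<open>L(\<omega>)\<close>: the pairs \<open>(E, f)\<close> such that \<open>E\<close> is in the domain and \<open>f\<close> is a
  representative of \<open>\<nabla> \<times> \<nabla> \<times> E - \<omega>\<^sup>2 \<epsilon> E\<close>. That \<open>f\<close> is square integrable and divergence free is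
  automatic for \<open>\<omega>\<close> in the parameter domain.\<close>

definition pencil ::
    "(real \<Rightarrow> complex \<Rightarrow> complex) \<Rightarrow> (real \<Rightarrow> complex \<Rightarrow> complex) \<Rightarrow> complex
       \<Rightarrow> ((real^'n::{finite,numeral} \<Rightarrow> complex^3) \<times> (real^'n::{finite,numeral} \<Rightarrow> complex^3)) set" where
  "pencil eps\<^sub>p eps\<^sub>m \<omega> =
     {(E, f). E \<in> pencil_domain eps\<^sub>p eps\<^sub>m \<omega> \<and>
        (\<exists>F G. E has_curl F \<and> F has_curl G \<and>
           (AE x in lebesgue. f x = G x - (\<omega>\<^sup>2 * permittivity eps\<^sub>p eps\<^sub>m (x$1) \<omega>) *s E x))}"

definition pencil_ker ::
    "(real \<Rightarrow> complex \<Rightarrow> complex) \<Rightarrow> (real \<Rightarrow> complex \<Rightarrow> complex) \<Rightarrow> complex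
       \<Rightarrow> (real^'n::{finite,numeral} \<Rightarrow> complex^3) set" where
  "pencil_ker eps\<^sub>p eps\<^sub>m \<omega> = {E. (E, \<lambda>x. 0) \<in> pencil eps\<^sub>p eps\<^sub>m \<omega>}"

section \<open>Eigenvalues and geometric multiplicity\<close>

definition ae_zero :: "(real^'n \<Rightarrow> complex^3) \<Rightarrow> bool" where
  "ae_zero E \<longleftrightarrow> (AE x in lebesgue. E x = 0)"

definition ae_independent :: "(real^'n \<Rightarrow> complex^3) set \<Rightarrow> bool" where
  "ae_independent B \<longleftrightarrow>
     (\<forall>c :: (real^'n \<Rightarrow> complex^3) \<Rightarrow> complex.
        ae_zero (\<lambda>x. \<Sum>E\<in>B. c E *s E x) \<longrightarrow> (\<forall>E\<in>B. c E = 0))"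

text \<open>The complex dimension of the space of almost-everywhere classes of elements of \<open>V\<close>.\<close>

definition ae_dim :: "(real^'n \<Rightarrow> complex^3) set \<Rightarrow> enat" where
  "ae_dim V = (SUP B \<in> {B. finite B \<and> B \<subseteq> V \<and> ae_independent B}. enat (card B))"

definition is_eigenvalue ::
    "'n::{finite,numeral} itself \<Rightarrow> (real \<Rightarrow> complex \<Rightarrow> complex) \<Rightarrow> (real \<Rightarrow> complex \<Rightarrow> complex)
       \<Rightarrow> complex \<Rightarrow> bool" where
  "is_eigenvalue _ eps\<^sub>p eps\<^sub>m \<omega> \<longleftrightarrow> \<omega> \<in> param_domain eps\<^sub>p eps\<^sub>m \<and>
     (\<exists>E :: real^'n::{finite,numeral} \<Rightarrow> complex^3. E \<in> pencil_ker eps\<^sub>p eps\<^sub>m \<omega> \<and> \<not> ae_zero E)"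

definition geometric_multiplicity ::
    "'n::{finite,numeral} itself \<Rightarrow> (real \<Rightarrow> complex \<Rightarrow> complex) \<Rightarrow> (real \<Rightarrow> complex \<Rightarrow> complex)
       \<Rightarrow> complex \<Rightarrow> enat" where
  "geometric_multiplicity _ eps\<^sub>p eps\<^sub>m \<omega> =
     ae_dim (pencil_ker eps\<^sub>p eps\<^sub>m \<omega> :: (real^'n::{finite,numeral} \<Rightarrow> complex^3) set)"

end

theory Submission
  imports Defs "HOL-Computational_Algebra.Fundamental_Theorem_Algebra"
begin

text \<open>
  The permittivity depends on \<open>x\<^sub>1\<close> only, so the operators of the pencil commute with the translations
  along the second coordinate axis, and the kernel is invariant under the unit translation \<open>T\<close> in that
  direction (\<open>pencil_ker_translate\<close>). The theorem follows from the fact that \<open>T\<close> acts on \<open>L\<^sup>2\<close> without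
  algebraic relations: if \<open>E\<close> is not almost everywhere zero, then \<open>E, T E, T\<^sup>2 E, \<dots>\<close> are linearly
  independent, so a kernel that contains \<open>E\<close> is infinite-dimensional.

  A linear relation among these translates has the form \<open>p(T) E = 0\<close> with a nonzero complex polynomial
  \<open>p\<close>. By the fundamental theorem of algebra \<open>p(T)\<close> is a nonzero multiple of a product of factors
  \<open>T - z\<close>, so it suffices that each of these is injective on \<open>L\<^sup>2\<close>, which means that \<open>T\<close> has no
  eigenvalues (\<open>translation_no_eigenfunction\<close>). Suppose that \<open>T E = z E\<close>. Since \<open>T\<close> is an isometry,
  either \<open>E = 0\<close> or \<open>\<bar>z\<bar> = 1\<close>. In the latter case \<open>\<bar>E\<bar>\<^sup>2\<close> is periodic, and it has the same integral over
  each of the infinitely many congruent slabs that tile the space. As the total integral is finite,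
  all of these integrals vanish (\<open>periodic_integrable_AE_zero\<close>).
\<close>

section \<open>Translations and Lebesgue integration\<close>

lemma lebesgue_measurable_translation:
  "(\<lambda>x. x + a) \<in> lebesgue \<rightarrow>\<^sub>M (lebesgue :: 'a::euclidean_space measure)"
  using lebesgue_affine_measurable[of "\<lambda>_. 1" a]
  by (simp add: euclidean_representation add.commute)

lemma distr_lebesgue_translation:
  "distr lebesgue lebesgue (\<lambda>x. x + a) = (lebesgue :: 'a::euclidean_space measure)"
  using lebesgue_affine_euclidean[of "\<lambda>_. 1" a]
  by (simp add: euclidean_representation add.commute density_1)

lemma borel_measurable_lebesgue_translation:
  fixes a :: "'a::euclidean_space"
  shows "f \<in> borel_measurable lebesgue \<Longrightarrow> (\<lambda>x. f (x + a)) \<in> borel_measurable lebesgue"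
  using measurable_compose[OF lebesgue_measurable_translation] by blast

lemma AE_lebesgue_translation:
  fixes a :: "'a::euclidean_space"
  assumes "AE x in lebesgue. P x"
  shows "AE x in lebesgue. P (x + a)"
proof (rule AE_distrD[OF lebesgue_measurable_translation])
  show "AE x in distr lebesgue lebesgue (\<lambda>x. x + a). P x"
    unfolding distr_lebesgue_translation by (rule assms)
qed

lemma integrable_lebesgue_translation:
  fixes a :: "'a::euclidean_space" and f :: "'a \<Rightarrow> 'b::{banach, second_countable_topology}"
  assumes "integrable lebesgue f"
  shows "integrable lebesgue (\<lambda>x. f (x + a))"
  by (rule integrable_distr[OF lebesgue_measurable_translation])
     (simp add: assms distr_lebesgue_translation)

text \<open>Translating back and forth shows that a function and its translate are integrable or not
  simultaneously; if they are not, both integrals have the default value zero.\<close>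

lemma integral_lebesgue_translation:
  fixes a :: "'a::euclidean_space" and f :: "'a \<Rightarrow> 'b::{banach, second_countable_topology}"
  shows "(LINT x|lebesgue. f (x + a)) = (LINT x|lebesgue. f x)"
proof (cases "integrable lebesgue f")
  case True
  then show ?thesis
    using integral_distr[OF lebesgue_measurable_translation borel_measurable_integrable, of f a]
    by (simp add: distr_lebesgue_translation)
next
  case False
  moreover have "\<not> integrable lebesgue (\<lambda>x. f (x + a))"
    using integrable_lebesgue_translation[of "\<lambda>x. f (x + a)" "-a"] False by auto
  ultimately show ?thesis by (simp add: not_integrable_integral_eq)
qed

section \<open>Absence of eigenfunctions of a translation\<close>

text \<open>The half-open slabs between the hyperplanes \<open>x \<bullet> a = k (a \<bullet> a)\<close>, with \<open>k\<close> an integer, tile the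
  space and are permuted by the translation by \<open>a\<close>. A periodic function has the same integral \<open>c\<close>
  over each of them, so that \<open>n c\<close> is at most the total integral for every \<open>n\<close>.\<close>

lemma periodic_integrable_AE_zero:
  fixes a :: "'a::euclidean_space" and f :: "'a \<Rightarrow> real"
  assumes a: "a \<noteq> 0" and int: "integrable lebesgue f" and nonneg: "\<And>x. 0 \<le> f x"
    and per: "AE x in lebesgue. f (x + a) = f x"
  shows "AE x in lebesgue. f x = 0"
proof -
  have aa: "a \<bullet> a > 0" using a by simp
  define S where "S k = {x. \<lfloor>(x \<bullet> a) / (a \<bullet> a)\<rfloor> = k}" for k :: int
  have S_borel: "S k \<in> sets borel" for k
    unfolding S_def by measurable
  then have S_sets: "S k \<in> sets lebesgue" for k by simp
  define g where "g k x = indicator (S k) x * f x" for k x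
  have g_int: "integrable lebesgue (g k)" for k
    unfolding g_def using integrable_real_mult_indicator[OF S_sets int] by (simp add: mult.commute)
  have S_shift: "x + a \<in> S (k + 1) \<longleftrightarrow> x \<in> S k" for x k
    using aa by (simp add: S_def inner_add_left add_divide_distrib)
  have step: "integral\<^sup>L lebesgue (g (k + 1)) = integral\<^sup>L lebesgue (g k)" for k
  proof -
    have "integral\<^sup>L lebesgue (g (k + 1)) = (LINT x|lebesgue. g (k + 1) (x + a))"
      by (rule integral_lebesgue_translation[symmetric])
    also have "\<dots> = integral\<^sup>L lebesgue (g k)"
    proof (rule integral_cong_AE)
      show "(\<lambda>x. g (k + 1) (x + a)) \<in> borel_measurable lebesgue"
        by (intro borel_measurable_lebesgue_translation borel_measurable_integrable g_int)
      show "g k \<in> borel_measurable lebesgue"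
        by (intro borel_measurable_integrable g_int)
      show "AE x in lebesgue. g (k + 1) (x + a) = g k x"
        using per by eventually_elim (simp add: g_def indicator_def S_shift)
    qed
    finally show ?thesis .
  qed
  define c where "c = integral\<^sup>L lebesgue (g 0)"
  have const: "integral\<^sup>L lebesgue (g k) = c" for k
  proof (induction k rule: int_induct[where k = 0])
    case base
    show ?case by (simp add: c_def)
  next
    case (step1 i)
    then show ?case using step[of i] by simp
  next
    case (step2 i)
    then show ?case using step[of "i - 1"] by simp
  qed
  have c0: "0 \<le> c"
    unfolding c_def by (rule integral_nonneg_AE) (simp add: g_def nonneg)
  have bound: "real n * c \<le> integral\<^sup>L lebesgue f" for n :: nat
  proof -
    have "real n * c = (\<Sum>k\<in>int ` {..<n}. integral\<^sup>L lebesgue (g k))"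
      by (simp add: const card_image)
    also have "\<dots> = (LINT x|lebesgue. (\<Sum>k\<in>int ` {..<n}. g k x))"
      by (rule Bochner_Integration.integral_sum[symmetric]) (rule g_int)
    also have "\<dots> \<le> integral\<^sup>L lebesgue f"
    proof (rule integral_mono)
      show "integrable lebesgue (\<lambda>x. \<Sum>k\<in>int ` {..<n}. g k x)"
        by (intro Bochner_Integration.integrable_sum g_int)
      show "integrable lebesgue f" by (rule int)
      fix x
      have "(\<Sum>k\<in>int ` {..<n}. g k x)
          = (\<Sum>k\<in>int ` {..<n}. if k = \<lfloor>(x \<bullet> a) / (a \<bullet> a)\<rfloor> then f x else 0)"
        by (rule sum.cong) (auto simp: g_def S_def)
      also have "\<dots> \<le> f x"
        using nonneg[of x] by (simp add: sum.delta)
      finally show "(\<Sum>k\<in>int ` {..<n}. g k x) \<le> f x" .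
    qed
    finally show ?thesis .
  qed
  have "c = 0"
  proof (rule ccontr)
    assume "c \<noteq> 0"
    then obtain n where "integral\<^sup>L lebesgue f < real n * c"
      using c0 reals_Archimedean3[of c] by auto
    then show False using bound[of n] by simp
  qed
  then have "AE x in lebesgue. g k x = 0" for k
    using integral_nonneg_eq_0_iff_AE[OF g_int[of k]] const[of k] by (simp add: g_def nonneg)
  then have "AE x in lebesgue. \<forall>k. g k x = 0"
    by (simp add: AE_all_countable)
  then show ?thesis
  proof eventually_elim
    case (elim x)
    then have "g \<lfloor>(x \<bullet> a) / (a \<bullet> a)\<rfloor> x = 0" by blast
    then show ?case by (simp add: g_def S_def)
  qed
qed

lemma norm_complex_smult: "norm (c *s v) = norm c * norm (v :: complex^'n)"
  by (simp add: norm_vec_def norm_mult L2_set_right_distrib)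

lemma borel_measurable_complex_smult:
  fixes E :: "'a \<Rightarrow> complex^'n"
  assumes "E \<in> borel_measurable M"
  shows "(\<lambda>x. c *s E x) \<in> borel_measurable M"
proof -
  have "continuous_on UNIV (\<lambda>v::complex^'n. c *s v)"
    unfolding vector_scalar_mult_def by (intro continuous_intros)
  then show ?thesis
    using borel_measurable_continuous_on assms by blast
qed

lemma L2_translate:
  assumes "E \<in> L2"
  shows "(\<lambda>x. E (x + a)) \<in> L2"
  using assms borel_measurable_lebesgue_translation[of E a]
    integrable_lebesgue_translation[of "\<lambda>x. (norm (E x))\<^sup>2" a]
  by (simp add: L2_def)

lemma L2_diff_smult:
  assumes "E \<in> L2" "F \<in> L2"
  shows "(\<lambda>x. E x - c *s F x) \<in> L2"
proof -
  have meas: "(\<lambda>x. E x - c *s F x) \<in> borel_measurable lebesgue"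
    using assms by (auto simp: L2_def intro!: borel_measurable_diff borel_measurable_complex_smult)
  have "integrable lebesgue (\<lambda>x. 2 * (norm (E x))\<^sup>2 + 2 * (norm c)\<^sup>2 * (norm (F x))\<^sup>2)"
    using assms by (auto simp: L2_def)
  then have "integrable lebesgue (\<lambda>x. (norm (E x - c *s F x))\<^sup>2)"
  proof (rule Bochner_Integration.integrable_bound)
    show "(\<lambda>x. (norm (E x - c *s F x))\<^sup>2) \<in> borel_measurable lebesgue"
      using meas by measurable
    have "norm ((norm (E x - c *s F x))\<^sup>2)
        \<le> norm (2 * (norm (E x))\<^sup>2 + 2 * (norm c)\<^sup>2 * (norm (F x))\<^sup>2)" for x
    proof -
      have "norm (E x - c *s F x) \<le> norm (E x) + norm c * norm (F x)"
        using norm_triangle_ineq4[of "E x" "c *s F x"] by (simp add: norm_complex_smult)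
      then have "(norm (E x - c *s F x))\<^sup>2 \<le> (norm (E x) + norm c * norm (F x))\<^sup>2"
        by (rule power_mono) simp
      also have "\<dots> \<le> 2 * (norm (E x))\<^sup>2 + 2 * (norm c * norm (F x))\<^sup>2"
        using sum_squares_bound[of "norm (E x)" "norm c * norm (F x)"]
        by (simp add: power2_sum)
      finally show ?thesis by (simp add: power_mult_distrib)
    qed
    then show "AE x in lebesgue. norm ((norm (E x - c *s F x))\<^sup>2)
        \<le> norm (2 * (norm (E x))\<^sup>2 + 2 * (norm c)\<^sup>2 * (norm (F x))\<^sup>2)" by simp
  qed
  with meas show ?thesis by (simp add: L2_def)
qed

text \<open>Comparing the integrals of \<open>\<bar>E\<bar>\<^sup>2\<close> and of its translate gives \<open>\<bar>z\<bar> = 1\<close> unless \<open>E\<close> vanishes, and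
  \<open>\<bar>z\<bar> = 1\<close> makes \<open>\<bar>E\<bar>\<^sup>2\<close> periodic.\<close>

lemma translation_no_eigenfunction:
  fixes E :: "real^'n \<Rightarrow> complex^3"
  assumes a: "a \<noteq> 0" and E: "E \<in> L2" and eig: "ae_zero (\<lambda>x. E (x + a) - z *s E x)"
  shows "ae_zero E"
proof -
  define f where "f x = (norm (E x))\<^sup>2" for x
  have int: "integrable lebesgue f" using E by (simp add: L2_def f_def[abs_def])
  have nonneg: "0 \<le> f x" for x by (simp add: f_def)
  have scale: "AE x in lebesgue. f (x + a) = (norm z)\<^sup>2 * f x"
    using eig unfolding ae_zero_def
    by eventually_elim (simp add: f_def norm_complex_smult power_mult_distrib)
  have "integral\<^sup>L lebesgue f = (LINT x|lebesgue. f (x + a))"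
    by (rule integral_lebesgue_translation[symmetric])
  also have "\<dots> = (LINT x|lebesgue. (norm z)\<^sup>2 * f x)"
    by (rule integral_cong_AE)
       (use int scale in \<open>auto intro!: borel_measurable_lebesgue_translation\<close>)
  finally have "integral\<^sup>L lebesgue f = (norm z)\<^sup>2 * integral\<^sup>L lebesgue f" by simp
  then consider "integral\<^sup>L lebesgue f = 0" | "(norm z)\<^sup>2 = 1" by auto
  then have "AE x in lebesgue. f x = 0"
  proof cases
    case 1
    then show ?thesis
      using integral_nonneg_eq_0_iff_AE[OF int] nonneg by simp
  next
    case 2
    with scale have "AE x in lebesgue. f (x + a) = f x" by simp
    then show ?thesis by (rule periodic_integrable_AE_zero[OF a int nonneg])
  qed
  then show ?thesis by (simp add: ae_zero_def f_def)
qed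

section \<open>Linear independence of the translates\<close>

text \<open>The sum is \<open>p(T) E\<close>, where \<open>T\<close> is the translation by \<open>a\<close>; any bound \<open>n\<close> above the
  degree gives the same value. If \<open>z\<close> is a root of \<open>p\<close> and \<open>p = (X - z) q\<close>, then
  \<open>p(T) E = q(T) ((T - z) E)\<close>, and the induction hypothesis applies to \<open>q\<close> and the function \<open>(T - z) E\<close>.\<close>

lemma polynomial_in_translation_injective:
  fixes E :: "real^'n \<Rightarrow> complex^3"
  assumes "a \<noteq> 0" and "p \<noteq> 0" and "degree p < n" and "E \<in> L2"
    and "ae_zero (\<lambda>x. \<Sum>i<n. coeff p i *s E (x + real i *\<^sub>R a))"
  shows "ae_zero E"
  using assms(2-)
proof (induction "degree p" arbitrary: p n E)
  case 0
  then obtain c where p: "p = [:c:]" by (metis degree_eq_zeroE)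
  with 0 have c: "c \<noteq> 0" by simp
  obtain m where n: "n = Suc m" using 0 by (cases n) auto
  have "(\<Sum>i<n. coeff p i *s E (x + real i *\<^sub>R a)) = c *s E x" for x
    by (simp add: p n sum.lessThan_Suc_shift del: sum.lessThan_Suc)
  with 0 have "ae_zero (\<lambda>x. c *s E x)" by simp
  with c show ?case by (simp add: ae_zero_def)
next
  case (Suc d)
  have "\<not> constant (poly p)" using Suc.hyps(2) by (simp add: constant_degree)
  then obtain z where "poly p z = 0" using fundamental_theorem_of_algebra by blast
  then obtain q where pq: "p = [:- z, 1:] * q" by (auto simp: poly_eq_0_iff_dvd elim: dvdE)
  with Suc have q: "q \<noteq> 0" by auto
  with pq have deg: "degree p = Suc (degree q)" by (simp add: degree_mult_eq del: mult_pCons_left)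
  obtain m where n: "n = Suc m" using Suc by (cases n) auto
  have m: "degree q < m" using Suc.prems deg n by simp
  define G where "G x = E (x + a) - z *s E x" for x
  have "(\<Sum>i<n. coeff p i *s E (x + real i *\<^sub>R a)) = (\<Sum>i<m. coeff q i *s G (x + real i *\<^sub>R a))" for x
  proof -
    let ?E = "\<lambda>i. E (x + real i *\<^sub>R a)"
    have coeff_p: "coeff p i = coeff (pCons 0 q) i - z * coeff q i" for i
      by (simp add: pq)
    have "(\<Sum>i<n. coeff p i *s ?E i)
        = (\<Sum>i<n. coeff (pCons 0 q) i *s ?E i) - (\<Sum>i<n. (z * coeff q i) *s ?E i)"
      by (simp only: coeff_p vec.scale_left_diff_distrib sum_subtractf)
    also have "(\<Sum>i<n. coeff (pCons 0 q) i *s ?E i) = (\<Sum>i<m. coeff q i *s ?E (Suc i))"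
      by (simp add: n sum.lessThan_Suc_shift del: sum.lessThan_Suc)
    \<comment> \<open>The top coefficient of \<open>z q\<close> in this range vanishes because \<open>m\<close> exceeds the degree of \<open>q\<close>.\<close>
    also have "(\<Sum>i<n. (z * coeff q i) *s ?E i) = (\<Sum>i<m. (z * coeff q i) *s ?E i)"
      using m by (simp add: n coeff_eq_0)
    finally show ?thesis
      by (simp add: G_def vec.scale_right_diff_distrib sum_subtractf algebra_simps)
  qed
  with Suc.prems have "ae_zero (\<lambda>x. \<Sum>i<m. coeff q i *s G (x + real i *\<^sub>R a))" by simp
  moreover have "G \<in> L2"
    unfolding G_def by (intro L2_diff_smult L2_translate Suc.prems)
  ultimately have "ae_zero G"
    using Suc.hyps(1)[of q m G] Suc.hyps(2) deg q m by simp
  then show ?case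
    unfolding G_def by (rule translation_no_eigenfunction[OF assms(1) Suc.prems(3)])
qed

lemma translates_no_linear_relation:
  fixes E :: "real^'n \<Rightarrow> complex^3"
  assumes "a \<noteq> 0" and "E \<in> L2" and "\<not> ae_zero E"
    and "ae_zero (\<lambda>x. \<Sum>i<n. c i *s E (x + real i *\<^sub>R a))" and "i < n"
  shows "c i = 0"
proof (rule ccontr)
  assume ci: "c i \<noteq> 0"
  define p where "p = (\<Sum>j<n. monom (c j) j)"
  have coeff_p: "coeff p j = (if j < n then c j else 0)" for j
    by (simp add: p_def coeff_sum coeff_monom sum.delta)
  have "p \<noteq> 0" using ci coeff_p[of i] assms(5) by auto
  moreover have "degree p < n"
  proof -
    have "degree p \<le> n - 1" by (rule degree_le) (auto simp: coeff_p)
    then show ?thesis using assms(5) by linarith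
  qed
  ultimately show False
    using polynomial_in_translation_injective[of a p n E] assms by (simp add: coeff_p)
qed

text \<open>The first \<open>n\<close> translates are to form an independent set with \<open>n\<close> elements, so they have to be
  distinct; two equal ones would themselves be a nontrivial linear relation.\<close>

lemma translation_invariant_ae_dim_infinite:
  fixes E :: "real^'n \<Rightarrow> complex^3"
  assumes a: "a \<noteq> 0" and L2: "E \<in> L2" and nz: "\<not> ae_zero E" and E: "E \<in> V"
    and inv: "\<And>F. F \<in> V \<Longrightarrow> (\<lambda>x. F (x + a)) \<in> V"
  shows "ae_dim V = \<infinity>"
proof -
  define T where "T i = (\<lambda>x. E (x + real i *\<^sub>R a))" for i :: nat
  have T_V: "T i \<in> V" for i
  proof (induction i)
    case 0
    show ?case using E by (simp add: T_def)
  next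
    case (Suc i)
    from inv[OF this] show ?case by (simp add: T_def algebra_simps)
  qed
  have inj: "inj T"
  proof (rule injI, rule ccontr)
    fix i j assume eq: "T i = T j" and ij: "i \<noteq> j"
    define n where "n = Suc (max i j)"
    define c where "c k = (if k = i then 1 else 0) - (if k = j then 1 else 0 :: complex)" for k
    have "(\<Sum>k<n. c k *s T k x) = 0" for x
    proof -
      have "(\<Sum>k<n. c k *s T k x)
          = (\<Sum>k<n. (if k = i then T k x else 0) - (if k = j then T k x else 0))"
        by (rule sum.cong) (auto simp: c_def)
      also have "\<dots> = T i x - T j x"
        by (simp add: sum_subtractf sum.delta n_def)
      finally show ?thesis using eq by simp
    qed
    then have "ae_zero (\<lambda>x. \<Sum>k<n. c k *s E (x + real k *\<^sub>R a))"
      by (simp add: ae_zero_def T_def)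
    from translates_no_linear_relation[OF a L2 nz this, of i] ij show False
      by (simp add: c_def n_def less_Suc_eq_le)
  qed
  have ind: "ae_independent (T ` {..<n})" for n
    unfolding ae_independent_def
  proof (intro allI impI)
    fix c :: "(real^'n \<Rightarrow> complex^3) \<Rightarrow> complex"
    assume "ae_zero (\<lambda>x. \<Sum>F\<in>T ` {..<n}. c F *s F x)"
    then have "ae_zero (\<lambda>x. \<Sum>i<n. c (T i) *s T i x)"
      by (simp add: sum.reindex inj_on_subset[OF inj])
    then have "ae_zero (\<lambda>x. \<Sum>i<n. c (T i) *s E (x + real i *\<^sub>R a))"
      by (simp add: T_def[THEN fun_cong])
    from translates_no_linear_relation[OF a L2 nz this]
    show "\<forall>F\<in>T ` {..<n}. c F = 0" by auto
  qed
  have "enat n \<le> ae_dim V" for n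
  proof -
    have "enat (card (T ` {..<n})) \<le> ae_dim V"
      unfolding ae_dim_def by (rule SUP_upper) (use T_V ind in auto)
    then show ?thesis by (simp add: card_image inj_on_subset[OF inj])
  qed
  then show ?thesis
    by (metis enat_ord_simps(1) not_less_eq_eq order_refl not_infinity_eq)
qed

section \<open>Translation invariance of the kernel\<close>

lemma has_derivative_translate_iff:
  fixes \<phi> :: "'a::real_normed_vector \<Rightarrow> 'b::real_normed_vector"
  shows "((\<lambda>x. \<phi> (x + a)) has_derivative D) (at x) \<longleftrightarrow> (\<phi> has_derivative D) (at (x + a))"
proof -
  have shift: "((\<lambda>x. f (x + b)) has_derivative D) (at y)"
    if "(f has_derivative D) (at (y + b))" for f :: "'a \<Rightarrow> 'b" and b y
  proof -
    have "((\<lambda>x. x + b) has_derivative (\<lambda>h. h)) (at y)"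
      by (auto intro!: derivative_eq_intros)
    from has_derivative_compose[OF this that] show ?thesis .
  qed
  show ?thesis using shift[of \<phi> x a] shift[of "\<lambda>x. \<phi> (x + a)" "x + a" "- a"] by auto
qed

lemma dir_deriv_translate:
  "dir_deriv v (\<lambda>x. \<phi> (x + a)) = (\<lambda>x. dir_deriv v \<phi> (x + a))"
  by (simp add: fun_eq_iff dir_deriv_def frechet_derivative_def has_derivative_translate_iff)

lemma Ck_translate: "Ck k \<phi> \<Longrightarrow> Ck k (\<lambda>x. \<phi> (x + a))"
proof (induction k arbitrary: \<phi>)
  case 0
  then show ?case
    by (auto intro!: continuous_on_compose2[of UNIV \<phi>] continuous_intros)
next
  case (Suc k)
  then show ?case
    by (auto simp: dir_deriv_translate differentiable_on_def differentiable_def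
        has_derivative_translate_iff)
qed

lemma test_functions_translate:
  assumes "\<phi> \<in> test_functions UNIV"
  shows "(\<lambda>x. \<phi> (x + a)) \<in> test_functions UNIV"
proof -
  have "{x. \<phi> (x + a) \<noteq> 0} = (\<lambda>x. x - a) ` {x. \<phi> x \<noteq> 0}"
    by (auto simp: image_iff) (metis add_diff_cancel)
  then have "closure {x. \<phi> (x + a) \<noteq> 0} = (\<lambda>x. x - a) ` closure {x. \<phi> x \<noteq> 0}"
    by (simp only: closure_translation_subtract)
  then show ?thesis
    using assms compact_translation_subtract[of "closure {x. \<phi> x \<noteq> 0}" a]
    by (simp add: test_functions_def Ck_translate del: compact_closure)
qed

lemma nabla_translate: "nabla (\<lambda>x. \<phi> (x + a)) = (\<lambda>x. nabla \<phi> (x + a))"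
  by (simp add: fun_eq_iff nabla_def dir_deriv_translate)

text \<open>Testing the translate of a field with \<open>\<phi>\<close> amounts to testing the field itself with \<open>\<phi>\<close> translated
  in the opposite direction.\<close>

lemma has_curl_translate:
  assumes "E has_curl F"
  shows "(\<lambda>x. E (x + a)) has_curl (\<lambda>x. F (x + a))"
  unfolding has_curl_def
proof (intro conjI ballI)
  show "(\<lambda>x. E (x + a)) \<in> L2" "(\<lambda>x. F (x + a)) \<in> L2"
    using assms by (simp_all add: has_curl_def L2_translate)
  fix \<phi> :: "real^'a::{finite,numeral} \<Rightarrow> complex" assume "\<phi> \<in> test_functions UNIV"
  define \<psi> where "\<psi> x = \<phi> (x + - a)" for x
  have "\<psi> \<in> test_functions UNIV"
    unfolding \<psi>_def by (rule test_functions_translate) fact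
  then have eq: "(LINT x|lebesgue. \<psi> x *s F x) = - (LINT x|lebesgue. ccross (nabla \<psi> x) (E x))"
    using assms by (simp add: has_curl_def)
  have \<phi>: "\<phi> = (\<lambda>x. \<psi> (x + a))" by (simp add: \<psi>_def)
  show "(LINT x|lebesgue. \<phi> x *s F (x + a))
      = - (LINT x|lebesgue. ccross (nabla \<phi> x) (E (x + a)))"
    unfolding \<phi> nabla_translate
    using eq integral_lebesgue_translation[of "\<lambda>x. \<psi> x *s F x" a]
      integral_lebesgue_translation[of "\<lambda>x. ccross (nabla \<psi> x) (E x)" a] by simp
qed

lemma div_free_translate:
  assumes "div_free G"
  shows "div_free (\<lambda>x. G (x + a))"
  unfolding div_free_def
proof
  fix \<phi> :: "real^'a::{finite,numeral} \<Rightarrow> complex" assume "\<phi> \<in> test_functions UNIV"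
  define \<psi> where "\<psi> x = \<phi> (x + - a)" for x
  have "\<psi> \<in> test_functions UNIV"
    unfolding \<psi>_def by (rule test_functions_translate) fact
  then have eq: "(LINT x|lebesgue. (\<Sum>j\<in>UNIV. nabla \<psi> x $ j * G x $ j)) = 0"
    using assms by (simp add: div_free_def)
  have \<phi>: "\<phi> = (\<lambda>x. \<psi> (x + a))" by (simp add: \<psi>_def)
  show "(LINT x|lebesgue. (\<Sum>j\<in>UNIV. nabla \<phi> x $ j * G (x + a) $ j)) = 0"
    unfolding \<phi> nabla_translate
    using eq integral_lebesgue_translation[of "\<lambda>x. \<Sum>j\<in>UNIV. nabla \<psi> x $ j * G x $ j" a] by simp
qed

lemma pencil_ker_translate:
  fixes a :: "real^'n::{finite,numeral}"
  assumes a: "a $ 1 = 0" and E: "E \<in> pencil_ker eps\<^sub>p eps\<^sub>m \<omega>"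
  shows "(\<lambda>x. E (x + a)) \<in> pencil_ker eps\<^sub>p eps\<^sub>m \<omega>"
proof -
  from E obtain F G where L2: "E \<in> L2" and FG: "E has_curl F" "F has_curl G"
    and div: "div_free (\<lambda>x. permittivity eps\<^sub>p eps\<^sub>m (x$1) \<omega> *s E x)"
    and ker: "AE x in lebesgue. 0 = G x - (\<omega>\<^sup>2 * permittivity eps\<^sub>p eps\<^sub>m (x$1) \<omega>) *s E x"
    by (auto simp: pencil_ker_def pencil_def pencil_domain_def)
  have curls: "(\<lambda>x. E (x + a)) has_curl (\<lambda>x. F (x + a))" "(\<lambda>x. F (x + a)) has_curl (\<lambda>x. G (x + a))"
    using FG by (simp_all add: has_curl_translate)
  have "(\<lambda>x. E (x + a)) \<in> pencil_domain eps\<^sub>p eps\<^sub>m \<omega>"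
    using L2_translate[OF L2, of a] curls div_free_translate[OF div, of a] a
    by (auto simp: pencil_domain_def)
  moreover have "AE x in lebesgue.
      0 = G (x + a) - (\<omega>\<^sup>2 * permittivity eps\<^sub>p eps\<^sub>m (x$1) \<omega>) *s E (x + a)"
    using AE_lebesgue_translation[OF ker, of a] a by simp
  ultimately show ?thesis
    using curls by (auto simp: pencil_ker_def pencil_def)
qed

text \<open>The hypothesis on the index type provides a direction orthogonal to the first axis; this is where
  the dimension has to be at least two.\<close>

lemma pencil_ker_trivial_or_infinite:
  assumes "(1::'n::{finite,numeral}) \<noteq> 2"
  shows "(\<forall>E \<in> (pencil_ker eps\<^sub>p eps\<^sub>m \<omega> :: (real^'n::{finite,numeral} \<Rightarrow> complex^3) set). ae_zero E) \<or>
    ae_dim (pencil_ker eps\<^sub>p eps\<^sub>m \<omega> :: (real^'n::{finite,numeral} \<Rightarrow> complex^3) set) = \<infinity>"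
proof (rule disjCI)
  assume fin: "\<not> ae_dim (pencil_ker eps\<^sub>p eps\<^sub>m \<omega> :: (real^'n::{finite,numeral} \<Rightarrow> complex^3) set) = \<infinity>"
  define a :: "real^'n::{finite,numeral}" where "a = axis 2 1"
  have a: "a \<noteq> 0" "a $ 1 = 0"
    using assms by (auto simp: a_def axis_def vec_eq_iff)
  show "\<forall>E \<in> (pencil_ker eps\<^sub>p eps\<^sub>m \<omega> :: (real^'n::{finite,numeral} \<Rightarrow> complex^3) set). ae_zero E"
  proof (rule ballI, rule ccontr)
    fix E :: "real^'n::{finite,numeral} \<Rightarrow> complex^3"
    assume E: "E \<in> pencil_ker eps\<^sub>p eps\<^sub>m \<omega>" and nz: "\<not> ae_zero E"
    have "E \<in> L2" using E by (simp add: pencil_ker_def pencil_def pencil_domain_def)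
    then have "ae_dim (pencil_ker eps\<^sub>p eps\<^sub>m \<omega> :: (real^'n::{finite,numeral} \<Rightarrow> complex^3) set) = \<infinity>"
      using translation_invariant_ae_dim_infinite[OF a(1) _ nz E] pencil_ker_translate[OF a(2)]
      by blast
    with fin show False by blast
  qed
qed

theorem theorem5p1:
  fixes eps\<^sub>p eps\<^sub>m :: "real \<Rightarrow> complex \<Rightarrow> complex"
  assumes "param_domain eps\<^sub>p eps\<^sub>m \<noteq> {}"
  shows "(\<nexists>\<omega>. is_eigenvalue TYPE(2) eps\<^sub>p eps\<^sub>m \<omega> \<and> geometric_multiplicity TYPE(2) eps\<^sub>p eps\<^sub>m \<omega> < \<infinity>) \<and>
    (\<nexists>\<omega>. is_eigenvalue TYPE(3) eps\<^sub>p eps\<^sub>m \<omega> \<and> geometric_multiplicity TYPE(3) eps\<^sub>p eps\<^sub>m \<omega> < \<infinity>) \<and>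
    (\<forall>\<omega> \<in> param_domain eps\<^sub>p eps\<^sub>m.
       (\<forall>E \<in> (pencil_ker eps\<^sub>p eps\<^sub>m \<omega> :: (real^2 \<Rightarrow> complex^3) set). ae_zero E) \<or>
       ae_dim (pencil_ker eps\<^sub>p eps\<^sub>m \<omega> :: (real^2 \<Rightarrow> complex^3) set) = \<infinity>) \<and>
    (\<forall>\<omega> \<in> param_domain eps\<^sub>p eps\<^sub>m.
       (\<forall>E \<in> (pencil_ker eps\<^sub>p eps\<^sub>m \<omega> :: (real^3 \<Rightarrow> complex^3) set). ae_zero E) \<or>
       ae_dim (pencil_ker eps\<^sub>p eps\<^sub>m \<omega> :: (real^3 \<Rightarrow> complex^3) set) = \<infinity>)"
proof -
  have "(1::2) \<noteq> 2" "(1::3) \<noteq> 2" by simp_all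
  note * = pencil_ker_trivial_or_infinite[OF this(1), of eps\<^sub>p eps\<^sub>m]
    pencil_ker_trivial_or_infinite[OF this(2), of eps\<^sub>p eps\<^sub>m]
  show ?thesis
    using * by (force simp: is_eigenvalue_def geometric_multiplicity_def)
qed

end
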